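(* Let $q$ be an even power of an odd prime with $\sqrt{q} \equiv -1 \pmod 4$. In $\mathrm{PG}(2,q)$ let $\mathcal{C}$ be the conic $X_2^2 - X_1X_3 = 0$ and let $\perp$ be the orthogonal polarity defined by $\mathcal{C}$, which maps the point $P=(x_1,x_2,x_3)$ to the line $P^\perp: x_3X_1 - 2x_2X_2 + x_1X_3 = 0$. Let $G$ be the group of collineations induced by the matrices $$\begin{pmatrix} a^2 & 2ac & c^2 \\ ab & ad+bc & cd \\ b^2 & 2bd & d^2 \end{pmatrix},\qquad a,b,c,d \in \mathbb{F}_{\sqrt{q}},\ ad-bc\neq 0.$$ Then there are $(\sqrt{q}+1)/2$ distinct $G$-orbits consisting of internal points of $\mathcal{C}$ such that, for every point $P$ in such an orbit, no point of the orbit $P^G$ lies on the line $P^\perp$.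
   Context: A point not on $\mathcal{C}$ is internal if it lies on no tangent line of $\mathcal{C}$; equivalently, $(x_1,x_2,x_3)\notin\mathcal{C}$ is internal iff $x_2^2-x_1x_3$ is a non-square in $\mathbb{F}_q$. Points are column vectors and matrices act on the left. *)

theory Defs
  imports "HOL-Analysis.Analysis" "HOL-Algebra.Group_Action" "HOL-Number_Theory.Cong"
begin

text \<open>
  The projective plane over a field: points and lines are the 1- and 2-dimensional subspaces of
  the space of column vectors of length 3, and incidence is inclusion.
\<close>

definition pg_points :: "('a::field ^ 3) set set" where
  "pg_points = {P. vec.subspace P \<and> vec.dim P = 1}"

definition pg_lines :: "('a::field ^ 3) set set" where
  "pg_lines = {l. vec.subspace l \<and> vec.dim l = 2}"

definition conic :: "('a::field ^ 3) set set" where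
  "conic = {P \<in> pg_points. \<forall>x\<in>P. (x $ 2)\<^sup>2 - x $ 1 * x $ 3 = 0}"

definition tangent :: "('a::field ^ 3) set \<Rightarrow> bool" where
  "tangent l \<longleftrightarrow> l \<in> pg_lines \<and> (\<exists>!P. P \<in> conic \<and> P \<subseteq> l)"

definition internal :: "('a::field ^ 3) set \<Rightarrow> bool" where
  "internal P \<longleftrightarrow> P \<in> pg_points \<and> P \<notin> conic \<and> (\<forall>l. tangent l \<longrightarrow> \<not> P \<subseteq> l)"

definition polar :: "('a::field ^ 3) set \<Rightarrow> ('a ^ 3) set" where
  "polar P = {X. \<forall>x\<in>P. x $ 3 * X $ 1 - 2 * x $ 2 * X $ 2 + x $ 1 * X $ 3 = 0}"

definition is_subfield :: "'a::field set \<Rightarrow> bool" where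
  "is_subfield K \<longleftrightarrow> 0 \<in> K \<and> 1 \<in> K \<and>
     (\<forall>x\<in>K. \<forall>y\<in>K. x + y \<in> K \<and> x * y \<in> K) \<and> (\<forall>x\<in>K. - x \<in> K \<and> inverse x \<in> K)"

definition G_matrix :: "'a::field \<Rightarrow> 'a \<Rightarrow> 'a \<Rightarrow> 'a \<Rightarrow> 'a ^ 3 ^ 3" where
  "G_matrix a b c d = vector
    [vector [a\<^sup>2,   2 * a * c,     c\<^sup>2],
     vector [a * b, a * d + b * c, c * d],
     vector [b\<^sup>2,   2 * b * d,     d\<^sup>2]]"

definition collineation :: "'a::field ^ 3 ^ 3 \<Rightarrow> ('a ^ 3) set \<Rightarrow> ('a ^ 3) set" where
  "collineation M = (\<lambda>P\<in>pg_points. (\<lambda>x. M *v x) ` P)"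

definition G_group :: "'a::field set \<Rightarrow> (('a ^ 3) set \<Rightarrow> ('a ^ 3) set) monoid" where
  "G_group K = (BijGroup pg_points)
     \<lparr>carrier := {collineation (G_matrix a b c d) | a b c d.
        a \<in> K \<and> b \<in> K \<and> c \<in> K \<and> d \<in> K \<and> a * d - b * c \<noteq> 0}\<rparr>"


text \<open>The carrier of \<^term>\<open>G_group K\<close> is a group of permutations of the points.\<close>

lemma G_matrix_mult:
  "G_matrix a b c d *v (G_matrix a' b' c' d' *v x) =
   G_matrix (a * a' + c * b') (b * a' + d * b') (a * c' + c * d') (b * c' + d * d') *v x"
  by (simp add: vec_eq_iff forall_3 G_matrix_def matrix_vector_mult_def sum_3 vector_3
      power2_eq_square algebra_simps)

lemma G_matrix_one: "G_matrix 1 0 0 1 *v x = x"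
  by (simp add: vec_eq_iff forall_3 G_matrix_def matrix_vector_mult_def sum_3 vector_3)

lemma G_matrix_inverse:
  assumes "a * d - b * c \<noteq> 0"
  defines "e \<equiv> inverse (a * d - b * c)"
  shows "G_matrix (e * d) (- (e * b)) (- (e * c)) (e * a) *v (G_matrix a b c d *v x) = x"
    and "G_matrix a b c d *v (G_matrix (e * d) (- (e * b)) (- (e * c)) (e * a) *v x) = x"
proof -
  have e: "e * (a * d - b * c) = 1"
    using assms by simp
  have "e * d * a + - (e * c) * b = 1" "- (e * b) * a + e * a * b = 0"
    "e * d * c + - (e * c) * d = 0" "- (e * b) * c + e * a * d = 1"
    "a * (e * d) + c * - (e * b) = 1" "b * (e * d) + d * - (e * b) = 0"
    "a * - (e * c) + c * (e * a) = 0" "b * - (e * c) + d * (e * a) = 1"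
    using e by (simp_all add: algebra_simps)
  then show "G_matrix (e * d) (- (e * b)) (- (e * c)) (e * a) *v (G_matrix a b c d *v x) = x"
    and "G_matrix a b c d *v (G_matrix (e * d) (- (e * b)) (- (e * c)) (e * a) *v x) = x"
    by (simp_all only: G_matrix_mult G_matrix_one)
qed

lemma image_pg_points:
  fixes M :: "'a::field ^ 3 ^ 3"
  assumes "P \<in> pg_points" and "inj ((*v) M)"
  shows "(\<lambda>x. M *v x) ` P \<in> pg_points"
proof -
  have "vec.dim ((*v) M ` P) = vec.dim P"
    by (rule vec.dim_image_eq) (use assms in \<open>auto intro: inj_on_subset\<close>)
  then show ?thesis
    using assms by (auto simp: pg_points_def intro: vec.subspace_image)
qed

lemma collineation_Bij:
  fixes a :: "'a::field"
  assumes "a * d - b * c \<noteq> 0"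
  shows "collineation (G_matrix a b c d) \<in> Bij pg_points"
proof -
  define e where "e = inverse (a * d - b * c)"
  let ?M = "G_matrix a b c d" and ?N = "G_matrix (e * d) (- (e * b)) (- (e * c)) (e * a)"
  have NM: "?N *v (?M *v x) = x" and MN: "?M *v (?N *v x) = x" for x
    using G_matrix_inverse[OF assms] by (simp_all add: e_def)
  have "inj ((*v) ?M)" "inj ((*v) ?N)"
    by (metis NM injI, metis MN injI)
  then have "bij_betw (\<lambda>P. (\<lambda>x. ?M *v x) ` P) pg_points pg_points"
    by (intro bij_betw_byWitness[where f' = "\<lambda>P. (\<lambda>x. ?N *v x) ` P"])
      (auto simp: image_image NM MN image_pg_points)
  then show ?thesis
    by (simp add: Bij_def collineation_def bij_betw_restrict_eq)
qed

lemma collineation_compose: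
  fixes a :: "'a::field"
  assumes "a' * d' - b' * c' \<noteq> 0"
  shows "compose pg_points (collineation (G_matrix a b c d)) (collineation (G_matrix a' b' c' d'))
    = collineation (G_matrix (a * a' + c * b') (b * a' + d * b') (a * c' + c * d') (b * c' + d * d'))"
proof -
  have "collineation (G_matrix a' b' c' d') P \<in> pg_points" if "P \<in> pg_points" for P
    using Bij_imp_funcset[OF collineation_Bij[OF assms]] that by blast
  then show ?thesis
    by (auto simp: fun_eq_iff compose_def collineation_def image_image G_matrix_mult)
qed

lemma subgroup_G_group:
  fixes K :: "'a::field set"
  assumes K: "is_subfield K"
  shows "subgroup (carrier (G_group K)) (BijGroup pg_points)"
proof -
  let ?H = "carrier (G_group K)" and ?B = "BijGroup (pg_points :: ('a ^ 3) set set)"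
  interpret B: group ?B by (rule group_BijGroup)
  have mem: "f \<in> ?H \<longleftrightarrow> (\<exists>a b c d. f = collineation (G_matrix a b c d) \<and>
      a \<in> K \<and> b \<in> K \<and> c \<in> K \<and> d \<in> K \<and> a * d - b * c \<noteq> 0)" for f
    by (auto simp: G_group_def)
  have memI: "collineation (G_matrix a b c d) \<in> ?H"
    if "a * d - b * c \<noteq> 0" "a \<in> K" "b \<in> K" "c \<in> K" "d \<in> K" for a b c d
    using that by (auto simp: mem)
  have Bij: "f \<in> Bij pg_points" if "f \<in> ?H" for f
    using that collineation_Bij by (auto simp: mem)
  have carr: "carrier ?B = Bij pg_points"
    by (simp add: BijGroup_def)
  have mult: "f \<otimes>\<^bsub>?B\<^esub> g = compose pg_points f g" if "f \<in> ?H" "g \<in> ?H" for f g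
    using that by (simp add: BijGroup_def Bij)
  have one: "collineation (G_matrix 1 0 0 (1::'a)) = \<one>\<^bsub>?B\<^esub>"
    by (auto simp: fun_eq_iff collineation_def BijGroup_def G_matrix_one)
  have closed: "f \<otimes>\<^bsub>?B\<^esub> g \<in> ?H" if fg: "f \<in> ?H" "g \<in> ?H" for f g
  proof -
    obtain a b c d where f: "f = collineation (G_matrix a b c d)"
      "a \<in> K" "b \<in> K" "c \<in> K" "d \<in> K" "a * d - b * c \<noteq> 0"
      using fg by (auto simp: mem)
    obtain a' b' c' d' where g: "g = collineation (G_matrix a' b' c' d')"
      "a' \<in> K" "b' \<in> K" "c' \<in> K" "d' \<in> K" "a' * d' - b' * c' \<noteq> 0"
      using fg by (auto simp: mem)
    have "(a * a' + c * b') * (b * c' + d * d') - (b * a' + d * b') * (a * c' + c * d')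
        = (a * d - b * c) * (a' * d' - b' * c')"
      by (simp add: algebra_simps)
    also have "\<dots> \<noteq> 0"
      using f g by simp
    finally have "compose pg_points f g \<in> ?H"
      unfolding f(1) g(1) collineation_compose[OF g(6)]
      by (rule memI) (use f g K in \<open>auto simp: is_subfield_def\<close>)
    then show ?thesis
      by (simp add: mult[OF fg])
  qed
  have inv: "inv\<^bsub>?B\<^esub> f \<in> ?H" if fH: "f \<in> ?H" for f
  proof -
    obtain a b c d where f: "f = collineation (G_matrix a b c d)"
      "a \<in> K" "b \<in> K" "c \<in> K" "d \<in> K" "a * d - b * c \<noteq> 0"
      using fH by (auto simp: mem)
    define e where "e = inverse (a * d - b * c)"
    let ?g = "collineation (G_matrix (e * d) (- (e * b)) (- (e * c)) (e * a))"
    have "a * d + - (b * c) \<in> K"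
      using f K unfolding is_subfield_def by blast
    then have "e \<in> K"
      using K by (simp add: is_subfield_def e_def)
    moreover have "(e * d) * (e * a) - (- (e * b)) * (- (e * c)) = e * e * (a * d - b * c)"
      by (simp add: algebra_simps)
    then have "(e * d) * (e * a) - (- (e * b)) * (- (e * c)) \<noteq> 0"
      using f(6) by (simp add: e_def)
    ultimately have g: "?g \<in> ?H"
      by (intro memI) (use f K in \<open>auto simp: is_subfield_def\<close>)
    have "compose pg_points ?g f = \<one>\<^bsub>?B\<^esub>"
    proof -
      have e: "e * (a * d - b * c) = 1"
        using f by (simp add: e_def)
      have "e * d * a + - (e * c) * b = 1" "- (e * b) * a + e * a * b = 0"
        "e * d * c + - (e * c) * d = 0" "- (e * b) * c + e * a * d = 1"
        using e by (simp_all add: algebra_simps)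
      then show ?thesis
        unfolding f(1) collineation_compose[OF f(6)] by (simp only: one)
    qed
    then have "?g \<otimes>\<^bsub>?B\<^esub> f = \<one>\<^bsub>?B\<^esub>"
      by (simp add: mult g fH)
    then have "inv\<^bsub>?B\<^esub> f = ?g"
      using g fH by (intro B.inv_equality) (auto simp: carr Bij)
    with g show ?thesis by simp
  qed
  have "\<one>\<^bsub>?B\<^esub> \<in> ?H"
    unfolding one[symmetric] by (rule memI) (use K in \<open>auto simp: is_subfield_def\<close>)
  then show ?thesis
    by (intro B.subgroupI) (auto simp: carr Bij closed inv)
qed

end

theory Submission
  imports Defs "HOL-Computational_Algebra.Polynomial"
begin

text \<open>
  Write \<open>F\<close> for the field with \<open>q\<close> elements and \<open>K\<close> for its subfield with \<open>s = \<surd>q\<close> elements.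
  Every element of \<open>K\<close> is a square in \<open>F\<close>, and \<open>-1\<close> is not a square in \<open>K\<close>. Let \<open>Q\<close> be the
  quadratic form of the conic and \<open>B\<close> its polar form; a point \<open>x\<close> is internal iff \<open>Q(x)\<close> is a
  nonsquare. Since \<open>|K|\<^sup>3 > |F|\<close>, every \<open>x\<close> is orthogonal to some nonzero vector \<open>w\<close> over \<open>K\<close>, and
  if \<open>x\<close> is internal then \<open>Q(w) \<noteq> 0\<close>. If \<open>Q(w)\<close> is a nonsquare in \<open>K\<close>, then \<open>-Q(w)\<close> is a square in
  \<open>K\<close>, and the quarter turn about \<open>w\<close> belongs to \<open>G\<close> and maps \<open>x\<close> into its own polar line.
  If \<open>Q(w)\<close> is a square in \<open>K\<close>, then \<open>G\<close> moves \<open>w\<close> to \<open>(0,1,0)\<close> and hence \<open>x\<close> to \<open>(1,0,t)\<close> with \<open>t\<close>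
  a nonsquare in \<open>F\<close>. The orbit of such a point avoids its polar line: the incidence
  \<open>c\<^sup>2t\<^sup>2 + (a\<^sup>2 + d\<^sup>2)t + b\<^sup>2 = 0\<close> means \<open>(ct + b)\<^sup>2 = (2bc - a\<^sup>2 - d\<^sup>2)t\<close>, which makes \<open>t\<close> a square.
  Finally \<open>(1,0,t)\<close> and \<open>(1,0,t')\<close> are in the same orbit iff \<open>t'\<close> is \<open>k\<^sup>2t\<close> or \<open>k\<^sup>2/t\<close> with
  \<open>k \<in> K\<close> nonzero, so the \<open>(q-1)/2\<close> nonsquares split into classes of size \<open>s-1\<close>.
\<close>

section \<open>Squares in a finite field and its quadratic subfield\<close>

lemma is_subfieldD:
  assumes "is_subfield K"
  shows "0 \<in> K" "1 \<in> K" "x \<in> K \<Longrightarrow> - x \<in> K" "x \<in> K \<Longrightarrow> inverse x \<in> K"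
    "x \<in> K \<Longrightarrow> y \<in> K \<Longrightarrow> x + y \<in> K" "x \<in> K \<Longrightarrow> y \<in> K \<Longrightarrow> x * y \<in> K"
    "x \<in> K \<Longrightarrow> y \<in> K \<Longrightarrow> x - y \<in> K" "x \<in> K \<Longrightarrow> y \<in> K \<Longrightarrow> x / y \<in> K"
    "x \<in> K \<Longrightarrow> x\<^sup>2 \<in> K" "2 \<in> K"
proof -
  have *: "0 \<in> K" "1 \<in> K" "\<And>x. x \<in> K \<Longrightarrow> - x \<in> K" "\<And>x. x \<in> K \<Longrightarrow> inverse x \<in> K"
    "\<And>x y. x \<in> K \<Longrightarrow> y \<in> K \<Longrightarrow> x + y \<in> K" "\<And>x y. x \<in> K \<Longrightarrow> y \<in> K \<Longrightarrow> x * y \<in> K"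
    using assms by (auto simp: is_subfield_def)
  show "0 \<in> K" "1 \<in> K" "x \<in> K \<Longrightarrow> - x \<in> K" "x \<in> K \<Longrightarrow> inverse x \<in> K"
    "x \<in> K \<Longrightarrow> y \<in> K \<Longrightarrow> x + y \<in> K" "x \<in> K \<Longrightarrow> y \<in> K \<Longrightarrow> x * y \<in> K"
    by (fact *)+
  show "x \<in> K \<Longrightarrow> y \<in> K \<Longrightarrow> x - y \<in> K"
    using *(5)[of x "- y"] *(3)[of y] by simp
  show "x \<in> K \<Longrightarrow> y \<in> K \<Longrightarrow> x / y \<in> K"
    using *(6)[of x "inverse y"] *(4)[of y] by (simp add: field_simps)
  show "x \<in> K \<Longrightarrow> x\<^sup>2 \<in> K"
    using *(6)[of x x] by (simp add: power2_eq_square)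
  show "2 \<in> K"
    using *(5)[of 1 1] *(2) by simp
qed

lemma is_subfield_UNIV: "is_subfield UNIV"
  by (simp add: is_subfield_def)

lemma card_eq_card_image_times:
  assumes "finite A" and "\<And>x. x \<in> A \<Longrightarrow> card {y \<in> A. f y = f x} = n"
  shows "card A = card (f ` A) * n"
proof -
  have "card A = (\<Sum>z \<in> f ` A. card {y \<in> A. f y = z})"
    using sum.image_gen[OF assms(1), of "\<lambda>_. 1::nat" f] by simp
  also have "\<dots> = (\<Sum>z \<in> f ` A. n)"
    by (rule sum.cong) (use assms in auto)
  finally show ?thesis by simp
qed

text \<open>Squaring has the fibres \<open>{x, - x}\<close> on nonzero elements. The form for an
  arbitrary subfield covers both \<open>K\<close> and the whole field.\<close>

lemma card_subfield_squares:
  fixes K :: "'a::{field,finite} set"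
  assumes K: "is_subfield K" and two: "(2::'a) \<noteq> 0"
  shows "card K - 1 = card ((\<lambda>x. x\<^sup>2) ` (K - {0})) * 2"
proof -
  have "card {y \<in> K - {0}. y\<^sup>2 = x\<^sup>2} = 2" if "x \<in> K - {0}" for x
  proof -
    have "{y \<in> K - {0}. y\<^sup>2 = x\<^sup>2} = {x, - x}"
      using that is_subfieldD(3)[OF K] by (auto simp: power2_eq_iff)
    moreover have "x \<noteq> - x"
    proof
      assume "x = - x"
      then have "2 * x = 0" unfolding mult_2 by (metis add.right_inverse)
      then show False using that two by simp
    qed
    ultimately show ?thesis by simp
  qed
  then have "card (K - {0}) = card ((\<lambda>x. x\<^sup>2) ` (K - {0})) * 2"
    by (intro card_eq_card_image_times) auto
  then show ?thesis
    using is_subfieldD(1)[OF K] by simp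
qed

text \<open>Fermat's argument: multiplication by \<open>a\<close> permutes \<open>K - {0}\<close>,
  and the product of all nonzero elements cancels.\<close>

lemma subfield_power_card:
  fixes K :: "'a::{field,finite} set"
  assumes K: "is_subfield K" and a: "a \<in> K" "a \<noteq> 0"
  shows "a ^ (card K - 1) = 1"
proof -
  have "bij_betw (\<lambda>x. a * x) (K - {0}) (K - {0})"
    by (rule bij_betw_byWitness[where f' = "\<lambda>x. x / a"]) (use a is_subfieldD(6,8)[OF K] in auto)
  then have "(\<Prod>x\<in>K - {0}. x) = (\<Prod>x\<in>K - {0}. a * x)"
    by (rule prod.reindex_bij_betw[symmetric])
  also have "\<dots> = a ^ card (K - {0}) * (\<Prod>x\<in>K - {0}. x)"
    by (simp add: prod.distrib)
  finally have "a ^ card (K - {0}) = 1"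
    by simp
  then show ?thesis
    using is_subfieldD(1)[OF K] by simp
qed

text \<open>The \<open>n\<close> nonzero squares are roots of \<open>X^n - 1\<close>, which has at
  most \<open>n\<close> roots, so they are all of its roots.\<close>

lemma euler_criterion_finite_field:
  fixes x :: "'a::{field,finite}"
  assumes two: "(2::'a) \<noteq> 0" and n: "CARD('a) - 1 = n * 2" and x: "x ^ n = 1"
  shows "\<exists>y. x = y\<^sup>2"
proof -
  let ?S = "(\<lambda>y::'a. y\<^sup>2) ` (UNIV - {0})" and ?p = "monom (1::'a) n - 1"
  have cS: "card ?S = n"
    using card_subfield_squares[OF is_subfield_UNIV two] n by simp
  \<comment> \<open>Positivity of \<open>n\<close> keeps the leading term of \<open>?p\<close> apart
    from its constant term, so that \<open>?p\<close> is nonzero.\<close>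
  have "1 \<in> ?S" by (rule image_eqI[of _ _ 1]) auto
  then have "n > 0"
    using cS card_gt_0_iff[of ?S] by auto
  have deg: "degree ?p \<le> n"
    by (rule degree_diff_le) (auto simp: degree_monom_eq)
  have "coeff ?p n = 1"
    using \<open>n > 0\<close> by (simp add: coeff_1)
  then have p: "?p \<noteq> 0" by force
  have "?S \<subseteq> {x. x ^ n = 1}"
  proof clarify
    fix y :: 'a assume "y \<noteq> 0"
    then have "y ^ (n * 2) = 1"
      using subfield_power_card[OF is_subfield_UNIV, of y] n by simp
    then show "(y\<^sup>2) ^ n = 1"
      by (simp add: power_mult[symmetric] mult.commute)
  qed
  moreover have "card {x::'a. x ^ n = 1} \<le> card ?S"
    using card_poly_roots_bound[OF p] deg cS by (simp add: poly_monom)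
  ultimately have "?S = {x. x ^ n = 1}"
    by (intro card_seteq) auto
  with x show ?thesis by auto
qed

text \<open>If \<open>2 = 0\<close>, then \<open>x + 1 + 1 = x\<close> splits the field into pairs
  \<open>{x, x + 1}\<close>, and its order is even.\<close>

lemma two_neq_0_odd_card:
  assumes "odd CARD('a::{field,finite})"
  shows "(2::'a) \<noteq> 0"
proof
  assume "(2::'a) = 0"
  then have *: "x + 1 + 1 = x" for x :: 'a
    by (simp add: add.assoc)
  have "{y. {y, y + 1} = {x, x + 1}} = {x, x + 1}" for x :: 'a
    using * by (auto simp: doubleton_eq_iff)
  then have "card {y \<in> UNIV. {y, y + 1} = {x, x + 1}} = 2" for x :: 'a
    by simp
  then have "CARD('a) = card (range (\<lambda>x::'a. {x, x + 1})) * 2"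
    by (intro card_eq_card_image_times) auto
  with assms show False by simp
qed

section \<open>The subfield of order \<open>s\<close> in the field of order
  \<open>s^2\<close>\<close>

locale quadratic_subfield =
  fixes K :: "'a::{field,finite} set" and s :: nat
  assumes subfield: "is_subfield K" and card_K: "card K = s"
    and card_F: "CARD('a) = s\<^sup>2" and s_mod_4: "s mod 4 = 3"
begin

lemmas K_closed = is_subfieldD[OF subfield]

lemma s_eq: obtains m where "s = 4 * m + 3"
  using s_mod_4 by (metis mult.commute div_mult_mod_eq)

lemma two_neq_0: "(2::'a) \<noteq> 0"
  by (rule two_neq_0_odd_card) (rule s_eq, simp add: card_F)

lemma subfield_is_square:
  assumes "k \<in> K"
  shows "\<exists>y. k = y\<^sup>2"
proof (cases "k = 0")
  case False
  obtain m where m: "s = 4 * m + 3" by (rule s_eq)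
  \<comment> \<open>Here \<open>2 * m + 2\<close> is \<open>(s + 1) / 2\<close>, so
    \<open>?n\<close> is the Euler exponent \<open>(s^2 - 1) / 2\<close> and a multiple of
    \<open>s - 1\<close>.\<close>
  let ?n = "(s - 1) * (2 * m + 2)"
  have "CARD('a) - 1 = ?n * 2"
    by (simp add: card_F m power2_eq_square algebra_simps)
  moreover have "k ^ ?n = 1"
    using subfield_power_card[OF subfield assms False] by (simp only: power_mult card_K power_one)
  ultimately show ?thesis
    using euler_criterion_finite_field[OF two_neq_0] by blast
qed (auto intro: exI[of _ 0])

text \<open>Since \<open>(s - 1) / 2\<close> is odd, \<open>a^2 = -1\<close> would give
  \<open>a ^ (s - 1) = -1\<close>, against Fermat.\<close>

lemma neg_1_not_subfield_square:
  assumes "a \<in> K"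
  shows "a\<^sup>2 \<noteq> -1"
proof
  assume a: "a\<^sup>2 = -1"
  obtain m where m: "s = 4 * m + 3" by (rule s_eq)
  have "a ^ (s - 1) = (a\<^sup>2) ^ (2 * m + 1)"
    by (simp only: m flip: power_mult) simp
  also have "\<dots> = -1" by (simp add: a)
  also have "a ^ (s - 1) = 1"
  proof -
    have "a \<noteq> 0" using a by auto
    then show ?thesis
      using subfield_power_card[OF subfield assms] by (simp add: card_K)
  qed
  finally have "(1::'a) + 1 = 0" by simp
  then show False using two_neq_0 by simp
qed

text \<open>As \<open>-1\<close> is a nonsquare in \<open>K\<close>, the nonzero squares and their
  negatives are disjoint; each set has \<open>(s - 1) / 2\<close> elements, so together they fill
  \<open>K - {0}\<close>.\<close>

lemma square_or_neg_square:
  assumes "k \<in> K"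
  obtains a where "a \<in> K" "k = a\<^sup>2" | a where "a \<in> K" "- k = a\<^sup>2"
proof -
  let ?S = "(\<lambda>x. x\<^sup>2) ` (K - {0})"
  have inter: "?S \<inter> uminus ` ?S = {}"
  proof -
    have False if "x \<in> K" "y \<in> K" "y \<noteq> 0" "x\<^sup>2 = - y\<^sup>2" for x y
      using neg_1_not_subfield_square[of "x / y"] that K_closed
      by (simp add: power_divide)
    then show ?thesis by auto
  qed
  have "card (?S \<union> uminus ` ?S) = card ?S + card (uminus ` ?S)"
    using inter by (intro card_Un_disjoint) auto
  also have "card (uminus ` ?S) = card ?S"
    by (intro card_image) (auto simp: inj_on_def)
  also have "card ?S + card ?S = card (K - {0})"
    using card_subfield_squares[OF subfield two_neq_0] K_closed(1) by simp
  finally have "?S \<union> uminus ` ?S = K - {0}"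
    by (intro card_subset_eq) (auto simp: K_closed)
  then have "k = 0 \<or> k \<in> ?S \<or> k \<in> uminus ` ?S"
    using assms by blast
  then show ?thesis
    using that K_closed(1) by force
qed

end

section \<open>The conic and its internal points\<close>

definition conic_form :: "'a::field ^ 3 \<Rightarrow> 'a" where
  "conic_form x = (x $ 2)\<^sup>2 - x $ 1 * x $ 3"

text \<open>The sign follows the equation of \<open>polar\<close>, so this is minus the usual
  polarization: \<open>polar_form x x = - 2 * conic_form x\<close>.\<close>

definition polar_form :: "'a::field ^ 3 \<Rightarrow> 'a ^ 3 \<Rightarrow> 'a" where
  "polar_form x y = x $ 3 * y $ 1 - 2 * x $ 2 * y $ 2 + x $ 1 * y $ 3"

lemma G_matrix_mult_vec:
  "(G_matrix a b c d *v x) $ 1 = a\<^sup>2 * x $ 1 + 2 * a * c * x $ 2 + c\<^sup>2 * x $ 3"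
  "(G_matrix a b c d *v x) $ 2 = a * b * x $ 1 + (a * d + b * c) * x $ 2 + c * d * x $ 3"
  "(G_matrix a b c d *v x) $ 3 = b\<^sup>2 * x $ 1 + 2 * b * d * x $ 2 + d\<^sup>2 * x $ 3"
  by (simp_all add: G_matrix_def matrix_vector_mult_def sum_3 vector_3)

text \<open>Read \<open>x\<close> as the symmetric matrix \<open>X\<close> with rows
  \<open>(x1,x2)\<close> and \<open>(x2,x3)\<close>, and let \<open>N\<close> have columns
  \<open>(a,b)\<close> and \<open>(c,d)\<close>. The action is \<open>X\<close> to
  \<open>N X N^T\<close>, and \<open>conic_form\<close> is minus the determinant.\<close>

lemma conic_form_G_matrix:
  "conic_form (G_matrix a b c d *v x) = (a * d - b * c)\<^sup>2 * conic_form x"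
  unfolding conic_form_def G_matrix_mult_vec by algebra

lemma polar_form_G_matrix:
  "polar_form (G_matrix a b c d *v x) (G_matrix a b c d *v y) = (a * d - b * c)\<^sup>2 * polar_form x y"
  unfolding polar_form_def G_matrix_mult_vec by algebra

text \<open>The 2 by 2 matrix with columns \<open>(a,b)\<close> and \<open>(c,d)\<close> is here \<open>\<alpha> + W\<close> with \<open>W\<close> traceless and \<open>W\<^sup>2 = Q(w)\<close>.\<close>

lemma polar_form_quarter_turn:
  fixes x w :: "'a::field ^ 3"
  shows "polar_form x (G_matrix (\<alpha> - w $ 2) (- w $ 3) (w $ 1) (\<alpha> + w $ 2) *v x) =
    (polar_form x w)\<^sup>2 - 2 * conic_form x * (\<alpha>\<^sup>2 + conic_form w)"
  unfolding polar_form_def conic_form_def G_matrix_mult_vec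
  by (simp add: power2_eq_square algebra_simps)

lemma polar_form_commute: "polar_form x y = polar_form y x"
  by (simp add: polar_form_def algebra_simps)

lemma conic_form_add_smult:
  "conic_form (k *s x + l *s y) = k\<^sup>2 * conic_form x - k * l * polar_form x y + l\<^sup>2 * conic_form y"
  unfolding conic_form_def polar_form_def
  by (simp add: power2_eq_square algebra_simps)

lemma conic_form_smult: "conic_form (k *s x) = k\<^sup>2 * conic_form x"
  by (simp add: conic_form_def power2_eq_square algebra_simps)

lemma polar_form_smult:
  "polar_form (k *s x) y = k * polar_form x y" "polar_form x (k *s y) = k * polar_form x y"
  by (simp_all add: polar_form_def algebra_simps)

section \<open>Points and lines as spans of vectors\<close>

lemma vec_dim_singleton: "x \<noteq> 0 \<Longrightarrow> vec.dim {x :: 'a::field ^ 'n} = 1"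
  using vec.dim_eq_card_independent[of "{x}"] by (simp add: vec.dependent_single)

lemma span_singleton_in_pg_points: "x \<noteq> 0 \<Longrightarrow> vec.span {x} \<in> pg_points"
  by (simp add: pg_points_def vec.dim_span vec_dim_singleton)

lemma pg_points_eq_span:
  assumes "P \<in> pg_points" "x \<in> P" "x \<noteq> 0"
  shows "P = vec.span {x}"
  using assms unfolding pg_points_def
  by (intro vec.subspace_dim_equal[symmetric] vec.span_minimal)
    (auto simp: vec.dim_span vec_dim_singleton)

lemma pg_points_nonzero:
  assumes "P \<in> pg_points"
  obtains x where "x \<in> P" "x \<noteq> 0"
proof -
  have "\<not> P \<subseteq> {0}"
  proof
    assume "P \<subseteq> {0}"
    then have "vec.dim P = 0"
      by (simp add: vec.dim_eq_0)
    then show False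
      using assms by (simp add: pg_points_def del: vec.dim_eq_0)
  qed
  then show ?thesis using that by auto
qed

lemma pg_pointsE:
  assumes "P \<in> pg_points"
  obtains x where "P = vec.span {x}" "x \<noteq> 0"
  using assms pg_points_nonzero pg_points_eq_span by metis

lemma span_in_conic_iff:
  "x \<noteq> 0 \<Longrightarrow> vec.span {x} \<in> conic \<longleftrightarrow> conic_form x = 0"
  using span_singleton_in_pg_points[of x]
  unfolding conic_def conic_form_def[symmetric]
  by (auto simp: conic_form_smult vec.span_singleton dest: spec[of _ 1])

lemma span_subset_polar_iff:
  "vec.span {y} \<subseteq> polar (vec.span {x}) \<longleftrightarrow> polar_form x y = 0"
proof
  assume "vec.span {y} \<subseteq> polar (vec.span {x})"
  then have "y \<in> polar (vec.span {x})"
    using vec.span_base[of y "{y}"] by blast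
  then show "polar_form x y = 0"
    using vec.span_base[of x "{x}"] by (auto simp: polar_def polar_form_def)
next
  assume "polar_form x y = 0"
  then show "vec.span {y} \<subseteq> polar (vec.span {x})"
    unfolding polar_def polar_form_def[symmetric]
    by (auto simp: vec.span_singleton polar_form_smult)
qed

text \<open>The polar line of a conic point \<open>w\<close> is its tangent. This is the algebraic
  reason why a point with nonsquare \<open>conic_form\<close> is on no tangent.\<close>

lemma conic_form_square_if_orthogonal:
  fixes x w :: "'a::field ^ 3"
  assumes w: "w \<noteq> 0" "conic_form w = 0" and xw: "polar_form x w = 0"
  shows "\<exists>y. conic_form x = y\<^sup>2"
proof (cases "w $ 1 = 0")
  case True
  then have "w $ 2 = 0" using w by (simp add: conic_form_def)
  with True w have "w $ 3 \<noteq> 0" by (auto simp: vec_eq_iff forall_3)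
  then have "x $ 1 = 0"
    using xw \<open>w $ 2 = 0\<close> True by (simp add: polar_form_def)
  then show ?thesis by (auto simp: conic_form_def)
next
  case False
  have "(w $ 1)\<^sup>2 * conic_form x = (x $ 2 * w $ 1 - x $ 1 * w $ 2)\<^sup>2"
    using w(2) xw unfolding conic_form_def polar_form_def by algebra
  then have "conic_form x = ((x $ 2 * w $ 1 - x $ 1 * w $ 2) / w $ 1)\<^sup>2"
    using False by (simp add: power_divide field_simps)
  then show ?thesis by blast
qed

lemma pg_lines_span_pair:
  fixes x y :: "'a::field ^ 3"
  assumes "x \<noteq> 0" "y \<notin> vec.span {x}"
  shows "vec.span {x, y} \<in> pg_lines"
proof -
  have "vec.independent {y, x}"
    using assms by (subst vec.independent_insert) (auto simp: vec.dependent_single)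
  moreover have "y \<noteq> x"
    using assms vec.span_base[of x "{x}"] by auto
  ultimately have "vec.dim {y, x} = 2"
    by (simp add: vec.dim_eq_card_independent)
  then show ?thesis
    by (simp add: pg_lines_def vec.dim_span insert_commute)
qed

text \<open>If \<open>conic_form x\<close> is a nonzero square, some conic point \<open>w\<close> is
  orthogonal to \<open>x\<close>, and the line joining them is tangent at \<open>w\<close>. If it is
  a nonsquare, every line through \<open>x\<close> and a conic point meets the conic a second
  time.\<close>

lemma internal_span_iff:
  fixes x :: "'a::field ^ 3"
  assumes x: "x \<noteq> 0"
  shows "internal (vec.span {x}) \<longleftrightarrow> (\<nexists>y. conic_form x = y\<^sup>2)"
proof
  assume int: "internal (vec.span {x})"
  show "\<nexists>y. conic_form x = y\<^sup>2"
  proof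
    assume "\<exists>y. conic_form x = y\<^sup>2"
    then obtain k where k: "conic_form x = k\<^sup>2" by blast
    have Qx: "conic_form x \<noteq> 0"
      using int x span_in_conic_iff unfolding internal_def by blast
    obtain w where w: "w \<noteq> 0" "conic_form w = 0" "polar_form x w = 0"
    proof (cases "x $ 1 = 0")
      case True
      show ?thesis
        by (rule that[of "vector [0, 0, 1]"])
          (simp_all add: conic_form_def polar_form_def True vec_eq_iff forall_3)
    next
      case False
      \<comment> \<open>The conic point \<open>(u^2, uv, v^2)\<close> is orthogonal to
        \<open>x\<close> iff \<open>x3 u^2 - 2 x2 uv + x1 v^2 = 0\<close>; the quadratic formula
        gives \<open>v / u = (x2 + k) / x1\<close>.\<close>
      let ?w = "vector [(x $ 1)\<^sup>2, x $ 1 * (x $ 2 + k), (x $ 2 + k)\<^sup>2] :: 'a ^ 3"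
      show ?thesis
      proof (rule that[of ?w])
        show "?w \<noteq> 0" using False by (simp add: vec_eq_iff forall_3)
        show "conic_form ?w = 0"
          by (simp add: conic_form_def power2_eq_square algebra_simps)
        have "x $ 3 * (x $ 1)\<^sup>2 - 2 * x $ 2 * (x $ 1 * (x $ 2 + k)) + x $ 1 * (x $ 2 + k)\<^sup>2 = 0"
          using k unfolding conic_form_def by algebra
        then show "polar_form x ?w = 0"
          by (simp add: polar_form_def)
      qed
    qed
    let ?l = "vec.span {w, x}"
    have "x \<notin> vec.span {w}"
      using Qx w by (auto simp: vec.span_singleton conic_form_smult)
    then have l: "?l \<in> pg_lines"
      using w by (intro pg_lines_span_pair)
    have "\<exists>!P. P \<in> conic \<and> P \<subseteq> ?l"
    proof (rule ex1I[of _ "vec.span {w}"])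
      show "vec.span {w} \<in> conic \<and> vec.span {w} \<subseteq> ?l"
        using w by (auto simp: span_in_conic_iff intro: vec.span_mono[THEN subsetD])
    next
      fix P assume P: "P \<in> conic \<and> P \<subseteq> ?l"
      then have "P \<in> pg_points" by (simp add: conic_def)
      then obtain y where y: "P = vec.span {y}" "y \<noteq> 0" by (rule pg_pointsE)
      have "y \<in> ?l"
        using P y vec.span_base[of y "{y}"] by blast
      then obtain a b where ab: "y = a *s w + b *s x"
        by (metis (no_types, lifting) vec.span_breakdown_eq vec.span_singleton add.commute diff_add_cancel rangeE)
      have "conic_form y = 0"
        using P y span_in_conic_iff by blast
      \<comment> \<open>The terms in \<open>w\<close> vanish because \<open>w\<close> is on the
        conic and orthogonal to \<open>x\<close>.\<close>
      then have "b\<^sup>2 * conic_form x = 0"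
        using w by (simp add: ab conic_form_add_smult polar_form_commute)
      then have "b = 0" using Qx by simp
      then have "w \<in> P"
        using y ab by (auto simp: vec.span_singleton intro!: image_eqI[of _ _ "inverse a"])
      then show "P = vec.span {w}"
        using \<open>P \<in> pg_points\<close> w pg_points_eq_span by blast
    qed
    then have "tangent ?l" using l by (simp add: tangent_def)
    moreover have "vec.span {x} \<subseteq> ?l"
      by (rule vec.span_mono) auto
    ultimately show False
      using int by (simp add: internal_def)
  qed
next
  assume nsq: "\<nexists>y. conic_form x = y\<^sup>2"
  then have Qx: "conic_form x \<noteq> 0"
    by (metis zero_power2)
  show "internal (vec.span {x})"
    unfolding internal_def
  proof (intro conjI allI impI notI)
    show "vec.span {x} \<in> pg_points" using x by (rule span_singleton_in_pg_points)
    show False if "vec.span {x} \<in> conic"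
      using that Qx x span_in_conic_iff by blast
    fix l assume l: "tangent l" "vec.span {x} \<subseteq> l"
    then obtain W where W: "W \<in> conic" "W \<subseteq> l" and uniq: "\<And>P. P \<in> conic \<Longrightarrow> P \<subseteq> l \<Longrightarrow> P = W"
      unfolding tangent_def by blast
    have "W \<in> pg_points" using W by (simp add: conic_def)
    then obtain w where w: "W = vec.span {w}" "w \<noteq> 0" by (rule pg_pointsE)
    have Qw: "conic_form w = 0" using W w span_in_conic_iff by blast
    have xl: "x \<in> l" "w \<in> l"
      using l W w vec.span_base[of x "{x}"] vec.span_base[of w "{w}"] by auto
    have sub: "vec.subspace l"
      using l by (simp add: tangent_def pg_lines_def)
    have "polar_form x w \<noteq> 0"
      using conic_form_square_if_orthogonal[OF w(2) Qw] nsq by blast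
    \<comment> \<open>The second intersection of the line \<open>xw\<close> with the conic: the
      coefficients solve \<open>conic_form (k *s x + l *s w) = 0\<close> with \<open>k\<close>
      nonzero.\<close>
    define z where "z = polar_form x w *s x + conic_form x *s w"
    have "conic_form z = 0"
      unfolding z_def conic_form_add_smult Qw by algebra
    have "z \<noteq> 0" "z \<notin> W"
    proof -
      have "z \<notin> W"
      proof
        assume "z \<in> W"
        then obtain m where "z = m *s w"
          unfolding w vec.span_singleton by blast
        then have "polar_form x w *s x = (m - conic_form x) *s w"
          unfolding z_def by (simp add: algebra_simps vector_add_ldistrib)
        then have "conic_form (polar_form x w *s x) = 0"
          by (simp only: conic_form_smult Qw mult_zero_right)
        then show False
          using Qx \<open>polar_form x w \<noteq> 0\<close> by (simp add: conic_form_smult)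
      qed
      then show "z \<noteq> 0" "z \<notin> W"
        using w vec.span_zero by auto
    qed
    moreover have "vec.span {z} \<subseteq> l"
      unfolding z_def using xl sub
      by (intro vec.span_minimal) (auto intro: vec.subspace_add vec.subspace_scale)
    moreover have "vec.span {z} \<in> conic"
      using \<open>z \<noteq> 0\<close> \<open>conic_form z = 0\<close> by (simp add: span_in_conic_iff)
    ultimately show False
      using uniq vec.span_base[of z "{z}"] by blast
  qed
qed

lemma span_image_matrix:
  fixes M :: "'a::field ^ 'n ^ 'm"
  shows "(\<lambda>x. M *v x) ` vec.span {x} = vec.span {M *v x}"
  by (auto simp: vec.span_singleton vector_scalar_commute image_image)

lemma is_square_smult_iff:
  fixes k :: "'a::field"
  assumes "k \<noteq> 0"
  shows "(\<exists>y. k\<^sup>2 * z = y\<^sup>2) \<longleftrightarrow> (\<exists>y. z = y\<^sup>2)"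
proof
  assume "\<exists>y. k\<^sup>2 * z = y\<^sup>2"
  then obtain y where "k\<^sup>2 * z = y\<^sup>2" by blast
  then have "z = (y / k)\<^sup>2" using assms by (simp add: power_divide field_simps)
  then show "\<exists>y. z = y\<^sup>2" by blast
next
  assume "\<exists>y. z = y\<^sup>2"
  then show "\<exists>y. k\<^sup>2 * z = y\<^sup>2" by (auto simp flip: power_mult_distrib)
qed

lemma G_matrix_mult_vec_eq_0_iff:
  fixes a :: "'a::field"
  assumes "a * d - b * c \<noteq> 0"
  shows "G_matrix a b c d *v x = 0 \<longleftrightarrow> x = 0"
  using G_matrix_inverse(1)[OF assms, of x] by (metis matrix_vector_mult_0_right)

section \<open>Orbits of internal points\<close>

lemma group_action_G_group:
  fixes K :: "'a::field set"
  assumes "is_subfield K"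
  shows "group_action (G_group K) pg_points (\<lambda>g. g)"
proof -
  let ?B = "BijGroup (pg_points :: ('a ^ 3) set set)"
  interpret B: group ?B by (rule group_BijGroup)
  have sub: "subgroup (carrier (G_group K)) ?B"
    using assms by (rule subgroup_G_group)
  have eq: "?B\<lparr>carrier := carrier (G_group K)\<rparr> = G_group K"
    by (simp add: G_group_def)
  have grp: "group (G_group K)"
    using B.subgroup_imp_group[OF sub] by (simp only: eq)
  have "(\<lambda>g. g) \<in> hom (G_group K) ?B"
  proof (rule homI)
    show "g \<in> carrier ?B" if "g \<in> carrier (G_group K)" for g
      using that subgroup.subset[OF sub] by blast
  qed (simp add: G_group_def)
  then show ?thesis
    by (simp add: group_action_def group_hom_def group_hom_axioms_def grp)
qed

context quadratic_subfield
begin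

abbreviation G_orbit :: "('a ^ 3) set \<Rightarrow> ('a ^ 3) set set" where
  "G_orbit \<equiv> orbit (G_group K) (\<lambda>g. g)"

interpretation action: group_action "G_group K" pg_points "\<lambda>g. g"
  using subfield by (rule group_action_G_group)

text \<open>Reduces statements about orbits to matrices acting on a representing vector.\<close>

lemma G_orbit_span:
  assumes "x \<noteq> 0"
  shows "G_orbit (vec.span {x}) = {vec.span {G_matrix a b c d *v x} | a b c d.
    a \<in> K \<and> b \<in> K \<and> c \<in> K \<and> d \<in> K \<and> a * d - b * c \<noteq> 0}"
proof -
  have "collineation M (vec.span {x}) = vec.span {M *v x}" for M
    using assms by (simp add: collineation_def span_singleton_in_pg_points span_image_matrix)
  then show ?thesis
    unfolding orbit_def G_group_def by (auto; metis)
qed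

lemma G_orbit_eq:
  assumes P: "P \<in> pg_points" and R: "R \<in> G_orbit P"
  shows "G_orbit R = G_orbit P"
proof -
  have mem: "S \<in> pg_points" if "T \<in> pg_points" "S \<in> G_orbit T" for S T
    using that action.element_image by (auto simp: orbit_def)
  have sub: "G_orbit S \<subseteq> G_orbit T" if "T \<in> pg_points" "S \<in> G_orbit T" for S T
    using that mem action.orbit_trans by blast
  show ?thesis
    using sub[OF P R] sub[OF mem[OF P R] action.orbit_sym[OF P mem[OF P R] R]] by blast
qed

section \<open>The orbits of the points \<open>(1,0,t)\<close>\<close>

text \<open>These are the points of the polar line of \<open>(0,1,0)\<close> other than
  \<open>(0,0,1)\<close>.\<close>

definition diag_point :: "'a \<Rightarrow> ('a ^ 3) set" where
  "diag_point t = vec.span {vector [1, 0, t]}"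

definition nonsquares :: "'a set" where
  "nonsquares = {t. \<nexists>y. t = y\<^sup>2}"

lemma vector_1_0_neq_0: "(vector [1, 0, t] :: 'a ^ 3) \<noteq> 0"
  by (simp add: vec_eq_iff forall_3)

lemma diag_point_in_pg_points: "diag_point t \<in> pg_points"
  unfolding diag_point_def using vector_1_0_neq_0 by (rule span_singleton_in_pg_points)

text \<open>Consequently \<open>1\<close> and a nonsquare \<open>t\<close> are linearly independent
  over \<open>K\<close>, which later lets coefficients be compared.\<close>

lemma nonsquares_not_in_subfield: "t \<in> nonsquares \<Longrightarrow> t \<notin> K"
  using subfield_is_square by (auto simp: nonsquares_def)

lemma card_nonsquares: "2 * card nonsquares = s\<^sup>2 - 1"
proof -
  let ?S = "(\<lambda>y::'a. y\<^sup>2) ` (UNIV - {0})"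
  have "nonsquares = (UNIV - {0}) - ?S"
    by (auto simp: nonsquares_def image_iff)
  moreover have "card ((UNIV - {0}) - ?S) = card (UNIV - {0::'a}) - card ?S"
    by (rule card_Diff_subset) auto
  ultimately show ?thesis
    using card_subfield_squares[OF is_subfield_UNIV two_neq_0] by (simp add: card_F)
qed

text \<open>Since \<open>-1\<close> lies in \<open>K\<close>, it is a square in the big field. This
  handles the sign in \<open>conic_form (1,0,t) = - t\<close>.\<close>

lemma neg_nonsquares_iff: "- t \<in> nonsquares \<longleftrightarrow> t \<in> nonsquares"
proof -
  obtain i :: 'a where "-1 = i\<^sup>2"
    using subfield_is_square[OF K_closed(3)[OF K_closed(2)]] by blast
  then have i: "- t = i\<^sup>2 * t" "i \<noteq> 0"
    by (metis mult_minus1) (use \<open>-1 = i\<^sup>2\<close> in auto)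
  show ?thesis
    by (simp only: nonsquares_def mem_Collect_eq i(1) is_square_smult_iff[OF i(2)])
qed

lemma internal_G_orbit_diag_point:
  assumes t: "t \<in> nonsquares" and P: "P \<in> G_orbit (diag_point t)"
  shows "internal P"
proof -
  let ?x = "vector [1, 0, t] :: 'a ^ 3"
  obtain a b c d where g: "a * d - b * c \<noteq> 0" "P = vec.span {G_matrix a b c d *v ?x}"
    using P unfolding diag_point_def G_orbit_span[OF vector_1_0_neq_0] by blast
  have "conic_form (G_matrix a b c d *v ?x) = (a * d - b * c)\<^sup>2 * (- t)"
    unfolding conic_form_G_matrix by (simp add: conic_form_def)
  then show ?thesis
    using t g neg_nonsquares_iff[of t] is_square_smult_iff[OF g(1), of "- t"]
    by (simp add: internal_span_iff G_matrix_mult_vec_eq_0_iff[OF g(1)] vector_1_0_neq_0 nonsquares_def)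
qed

lemma sum_squares_subfield_eq_0:
  assumes "a \<in> K" "d \<in> K" "a\<^sup>2 + d\<^sup>2 = 0"
  shows "a = 0 \<and> d = 0"
proof (cases "d = 0")
  case False
  have "a\<^sup>2 = - d\<^sup>2" using assms(3) by (simp add: eq_neg_iff_add_eq_0)
  then have "(a / d)\<^sup>2 = -1"
    using False by (simp add: power_divide)
  then show ?thesis
    using neg_1_not_subfield_square[of "a / d"] K_closed(8) assms by blast
qed (use assms in auto)

lemma diag_point_orbit_not_subset_polar:
  assumes t: "t \<in> nonsquares" and R: "R \<in> G_orbit (diag_point t)"
  shows "\<not> R \<subseteq> polar (diag_point t)"
proof
  assume sub: "R \<subseteq> polar (diag_point t)"
  let ?x = "vector [1, 0, t] :: 'a ^ 3"
  obtain a b c d where K: "a \<in> K" "b \<in> K" "c \<in> K" "d \<in> K" and det: "a * d - b * c \<noteq> 0"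
    and R: "R = vec.span {G_matrix a b c d *v ?x}"
    using R unfolding diag_point_def G_orbit_span[OF vector_1_0_neq_0] by blast
  have "polar_form ?x (G_matrix a b c d *v ?x) = 0"
    using sub by (simp only: R diag_point_def span_subset_polar_iff)
  then have "t * (a\<^sup>2 + c\<^sup>2 * t) + b\<^sup>2 + d\<^sup>2 * t = 0"
    by (simp add: polar_form_def G_matrix_mult_vec algebra_simps)
  then have sq: "(c * t + b)\<^sup>2 = (2 * b * c - a\<^sup>2 - d\<^sup>2) * t"
    by algebra
  let ?k = "2 * b * c - a\<^sup>2 - d\<^sup>2"
  have "?k \<in> K" using K by (intro K_closed)
  then obtain r where r: "?k = r\<^sup>2" using subfield_is_square by blast
  \<comment> \<open>Otherwise \<open>r^2 * t\<close> is a square with \<open>r\<close> nonzero, and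
    so is \<open>t\<close>. With \<open>r = 0\<close>, the relation \<open>c * t + b = 0\<close>
    over \<open>K\<close> forces \<open>c = 0\<close>, and a sum of two squares in \<open>K\<close>
    vanishes.\<close>
  have "r = 0"
    using t sq[symmetric] is_square_smult_iff[of r t] unfolding r nonsquares_def by blast
  then have "c * t = - b"
    using sq r by (simp add: eq_neg_iff_add_eq_0)
  have "c = 0"
  proof (rule ccontr)
    assume "c \<noteq> 0"
    then have "t = - b / c" using \<open>c * t = - b\<close> by (simp add: field_simps)
    then show False
      using nonsquares_not_in_subfield[OF t] K K_closed(3,8) by blast
  qed
  then have "a\<^sup>2 + d\<^sup>2 = 0"
    using r \<open>r = 0\<close> by (simp add: algebra_simps neg_eq_iff_add_eq_0)
  then show False
    using sum_squares_subfield_eq_0 K det \<open>c = 0\<close> by auto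
qed

text \<open>\<open>G\<close> preserves orthogonality, so an incidence of \<open>R\<close> with the
  polar of \<open>S\<close> is carried by the inverse matrix \<open>?h\<close> to one with the polar
  of \<open>P\<close>. It thus suffices to test one point of each orbit.\<close>

lemma polar_avoids_orbit_invariant:
  assumes P: "P \<in> pg_points" and avoid: "\<And>R. R \<in> G_orbit P \<Longrightarrow> \<not> R \<subseteq> polar P"
    and S: "S \<in> G_orbit P" and R: "R \<in> G_orbit S"
  shows "\<not> R \<subseteq> polar S"
proof
  assume sub: "R \<subseteq> polar S"
  obtain x where x: "P = vec.span {x}" "x \<noteq> 0" using P by (rule pg_pointsE)
  obtain a b c d where K: "a \<in> K" "b \<in> K" "c \<in> K" "d \<in> K" and det: "a * d - b * c \<noteq> 0"
    and S': "S = vec.span {G_matrix a b c d *v x}"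
    using S unfolding x G_orbit_span[OF x(2)] by blast
  define e where "e = inverse (a * d - b * c)"
  have eK: "e \<in> K" unfolding e_def using K by (intro K_closed)
  let ?h = "G_matrix (e * d) (- (e * b)) (- (e * c)) (e * a)"
  have det': "e * d * (e * a) - (- (e * b)) * (- (e * c)) \<noteq> 0"
  proof -
    have "e * d * (e * a) - (- (e * b)) * (- (e * c)) = e * e * (a * d - b * c)"
      by (simp add: algebra_simps)
    then show ?thesis using det by (simp add: e_def)
  qed
  have "R \<in> G_orbit P"
    using G_orbit_eq[OF P S] R by simp
  then obtain y where y: "R = vec.span {y}" "y \<noteq> 0"
    unfolding x G_orbit_span[OF x(2)] using G_matrix_mult_vec_eq_0_iff x(2) by blast
  have "polar_form (G_matrix a b c d *v x) y = 0"
    using sub by (simp only: S' y span_subset_polar_iff)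
  then have "polar_form (?h *v (G_matrix a b c d *v x)) (?h *v y) = 0"
    by (simp only: polar_form_G_matrix mult_zero_right)
  then have "polar_form x (?h *v y) = 0"
    using G_matrix_inverse(1)[OF det, of x] by (simp only: e_def)
  then have "vec.span {?h *v y} \<subseteq> polar P"
    by (simp only: x span_subset_polar_iff)
  moreover have "vec.span {?h *v y} \<in> G_orbit R"
    unfolding y G_orbit_span[OF y(2)] using K eK det' K_closed(3,6) by blast
  then have "vec.span {?h *v y} \<in> G_orbit P"
    using G_orbit_eq[OF P \<open>R \<in> G_orbit P\<close>] by simp
  ultimately show False using avoid by blast
qed

section \<open>Reduction of avoiding orbits to the points \<open>(1,0,t)\<close>\<close>

text \<open>By pigeonhole two distinct vectors over \<open>K\<close> have the same product with
  \<open>x\<close>; their difference is \<open>w\<close>.\<close>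

lemma exists_orthogonal_subfield_vector:
  obtains w :: "'a ^ 3" where "w \<noteq> 0" "\<forall>i. w $ i \<in> K" "polar_form x w = 0"
proof -
  let ?V = "K \<times> K \<times> K" and ?f = "\<lambda>(u, v, w). polar_form x (vector [u, v, w])"
  have "s > 1" using s_mod_4 by (cases "s \<le> 1") (auto simp: le_Suc_eq)
  have "card ?V = s * s\<^sup>2"
    by (simp add: card_cartesian_product card_K power2_eq_square)
  moreover have "card (?f ` ?V) \<le> s\<^sup>2"
    unfolding card_F[symmetric] by (rule card_mono) auto
  ultimately have "card (?f ` ?V) < card ?V"
    using \<open>s > 1\<close> by (smt (verit) less_le_trans mult_less_cancel2 mult_1 zero_less_power le_less_trans order.strict_trans zero_less_one)
  then have "\<not> inj_on ?f ?V"
    using pigeonhole by blast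
  then obtain u v w u' v' w' where K: "{u, v, w, u', v', w'} \<subseteq> K"
    and eq: "?f (u, v, w) = ?f (u', v', w')" and neq: "(u, v, w) \<noteq> (u', v', w')"
    unfolding inj_on_def by auto
  let ?w = "vector [u - u', v - v', w - w'] :: 'a ^ 3"
  show ?thesis
  proof (rule that[of ?w])
    show "?w \<noteq> 0" using neq by (auto simp: vec_eq_iff forall_3)
    show "\<forall>i. ?w $ i \<in> K"
      using K K_closed(7) by (simp add: forall_3)
    show "polar_form x ?w = 0"
      using eq by (simp add: polar_form_def algebra_simps)
  qed
qed

text \<open>The tangents at \<open>(1,0,0)\<close> and \<open>(0,0,1)\<close> meet in
  \<open>(0,1,0)\<close>. As \<open>conic_form w\<close> is a nonzero square in \<open>K\<close>,
  two tangents at conic points over \<open>K\<close> meet in \<open>w\<close>; their parameters are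
  the pairs \<open>(a,b)\<close> and \<open>(c,d)\<close>.\<close>

lemma exists_G_matrix_mapping_axis:
  fixes w :: "'a ^ 3"
  assumes K: "\<forall>i. w $ i \<in> K" and "k \<in> K" "k \<noteq> 0" and k: "conic_form w = k\<^sup>2"
  obtains a b c d m where "a \<in> K" "b \<in> K" "c \<in> K" "d \<in> K" "a * d - b * c \<noteq> 0" "m \<noteq> 0"
    "G_matrix a b c d *v vector [0, 1, 0] = m *s w"
proof (cases "w $ 1 = 0")
  case True
  then have "w $ 2 \<noteq> 0" using k \<open>k \<noteq> 0\<close> by (auto simp: conic_form_def)
  show ?thesis
  proof (rule that[of 0 1 "2 * w $ 2" "w $ 3" 2])
    show "G_matrix 0 1 (2 * w $ 2) (w $ 3) *v vector [0, 1, 0] = 2 *s w"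
      using True by (simp add: vec_eq_iff forall_3 G_matrix_mult_vec)
  qed (use K_closed(1,2,6,10) K \<open>w $ 2 \<noteq> 0\<close> two_neq_0 in auto)
next
  case False
  show ?thesis
  proof (rule that[of "w $ 1" "w $ 2 + k" "w $ 1" "w $ 2 - k" "2 * w $ 1"])
    have "2 * (w $ 2 + k) * (w $ 2 - k) = 2 * w $ 1 * w $ 3"
      using k unfolding conic_form_def by algebra
    then show "G_matrix (w $ 1) (w $ 2 + k) (w $ 1) (w $ 2 - k) *v vector [0, 1, 0] = (2 * w $ 1) *s w"
      by (simp add: vec_eq_iff forall_3 G_matrix_mult_vec power2_eq_square algebra_simps)
    have "w $ 1 * (w $ 2 - k) - (w $ 2 + k) * w $ 1 = - (2 * k * w $ 1)"
      by (simp add: algebra_simps)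
    then show "w $ 1 * (w $ 2 - k) - (w $ 2 + k) * w $ 1 \<noteq> 0"
      using False \<open>k \<noteq> 0\<close> two_neq_0 by simp
  qed (use K_closed(5,7) K \<open>k \<in> K\<close> False two_neq_0 in auto)
qed

lemma internal_avoiding_in_diag_orbit:
  assumes int: "internal P" and avoid: "\<And>R. R \<in> G_orbit P \<Longrightarrow> \<not> R \<subseteq> polar P"
  obtains t where "t \<in> nonsquares" "P \<in> G_orbit (diag_point t)"
proof -
  have "P \<in> pg_points" using int by (simp add: internal_def)
  then obtain x where x: "P = vec.span {x}" "x \<noteq> 0" by (rule pg_pointsE)
  have nsq: "\<nexists>y. conic_form x = y\<^sup>2"
    using int x internal_span_iff by blast
  obtain w :: "'a ^ 3" where w: "w \<noteq> 0" "\<forall>i. w $ i \<in> K" "polar_form x w = 0"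
    by (rule exists_orthogonal_subfield_vector[of x])
  have Qw0: "conic_form w \<noteq> 0"
    using conic_form_square_if_orthogonal[of w x] w nsq by blast
  have "conic_form w \<in> K"
    unfolding conic_form_def using w(2) by (intro K_closed) auto
  then consider k where "k \<in> K" "conic_form w = k\<^sup>2" | \<alpha> where "\<alpha> \<in> K" "- conic_form w = \<alpha>\<^sup>2"
    by (rule square_or_neg_square)
  then show ?thesis
  proof cases
    case 2
    let ?g = "G_matrix (\<alpha> - w $ 2) (- w $ 3) (w $ 1) (\<alpha> + w $ 2)"
    have "(\<alpha> - w $ 2) * (\<alpha> + w $ 2) - (- w $ 3) * w $ 1 = - (2 * conic_form w)"
      using 2(2) unfolding conic_form_def by algebra
    then have "(\<alpha> - w $ 2) * (\<alpha> + w $ 2) - (- w $ 3) * w $ 1 \<noteq> 0"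
      using Qw0 two_neq_0 by simp
    then have "vec.span {?g *v x} \<in> G_orbit P"
      unfolding x G_orbit_span[OF x(2)] using K_closed(3,5,7) spec[OF w(2)] 2(1) by blast
    \<comment> \<open>Both terms of the quarter turn formula vanish, by
      \<open>polar_form x w = 0\<close> and \<open>\<alpha>^2 = - conic_form w\<close>; this case
      contradicts the avoidance.\<close>
    moreover have "vec.span {?g *v x} \<subseteq> polar P"
      unfolding x span_subset_polar_iff polar_form_quarter_turn w(3) 2(2)[symmetric] by simp
    ultimately show ?thesis using avoid by blast
  next
    case 1
    then have "k \<noteq> 0" using Qw0 by auto
    obtain a b c d m where g: "a \<in> K" "b \<in> K" "c \<in> K" "d \<in> K" "a * d - b * c \<noteq> 0" "m \<noteq> 0"
      "G_matrix a b c d *v vector [0, 1, 0] = m *s w"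
      by (rule exists_G_matrix_mapping_axis[OF w(2) 1(1) \<open>k \<noteq> 0\<close> 1(2)])
    \<comment> \<open>The preimage of \<open>x\<close> under the matrix taking
      \<open>(0,1,0)\<close> to a multiple of \<open>w\<close>; it is orthogonal to
      \<open>(0,1,0)\<close>, so its middle coordinate is zero.\<close>
    define y where "y = (let e = inverse (a * d - b * c) in
      G_matrix (e * d) (- (e * b)) (- (e * c)) (e * a) *v x)"
    have xy: "x = G_matrix a b c d *v y"
      using G_matrix_inverse(2)[OF g(5), of x] by (simp add: y_def Let_def)
    have "polar_form x (m *s w) = 0" using w(3) by (simp add: polar_form_smult)
    then have "(a * d - b * c)\<^sup>2 * polar_form y (vector [0, 1, 0]) = 0"
      unfolding xy g(7)[symmetric] polar_form_G_matrix .
    then have y2: "y $ 2 = 0"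
      using g(5) two_neq_0 by (simp add: polar_form_def)
    have nsqy: "\<nexists>z. conic_form y = z\<^sup>2"
      using nsq is_square_smult_iff[OF g(5)] by (simp add: xy conic_form_G_matrix)
    then have y1: "y $ 1 \<noteq> 0"
      using y2 by (auto simp: conic_form_def)
    let ?t = "y $ 3 / y $ 1"
    have yt: "y = y $ 1 *s vector [1, 0, ?t]"
      using y1 y2 by (simp add: vec_eq_iff forall_3)
    show ?thesis
    proof (rule that[of ?t])
      have "conic_form y = (y $ 1)\<^sup>2 * (- ?t)"
        using y1 y2 by (simp add: conic_form_def power2_eq_square)
      then show "?t \<in> nonsquares"
        using nsqy is_square_smult_iff[OF y1, of "- ?t"] neg_nonsquares_iff[of ?t]
        by (simp add: nonsquares_def)
      have "vec.span {y} = diag_point ?t"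
      proof -
        have "y \<in> diag_point ?t"
          unfolding diag_point_def vec.span_singleton using yt by blast
        then show ?thesis
          using pg_points_eq_span[OF diag_point_in_pg_points, of y] y1 zero_index by metis
      qed
      moreover have "y \<noteq> 0" using y1 by auto
      ultimately show "P \<in> G_orbit (diag_point ?t)"
        using G_orbit_span[of y] g x xy by auto
    qed
  qed
qed

section \<open>Counting the orbits\<close>

text \<open>The middle coordinate of the image is \<open>a * b + c * d * t\<close>. It vanishes only
  if \<open>a * b = c * d = 0\<close>, so the 2 by 2 matrix is diagonal or antidiagonal, which gives
  the two alternatives.\<close>

lemma diag_points_same_orbit_iff:
  assumes t: "t \<in> nonsquares"
  shows "G_orbit (diag_point t') = G_orbit (diag_point t) \<longleftrightarrow>
    (\<exists>k\<in>K - {0}. t' = k\<^sup>2 * t \<or> t' = k\<^sup>2 / t)"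
proof -
  let ?x = "vector [1, 0, t] :: 'a ^ 3"
  have orb: "G_orbit (diag_point t') = G_orbit (diag_point t) \<longleftrightarrow> diag_point t' \<in> G_orbit (diag_point t)"
    using G_orbit_eq diag_point_in_pg_points action.orbit_refl by blast
  have t0: "t \<noteq> 0" using t by (auto simp: nonsquares_def)
  have gx: "(G_matrix a b c d *v ?x) $ 1 = a\<^sup>2 + c\<^sup>2 * t" "(G_matrix a b c d *v ?x) $ 2 = a * b + c * d * t"
    "(G_matrix a b c d *v ?x) $ 3 = b\<^sup>2 + d\<^sup>2 * t" for a b c d
    by (simp_all add: G_matrix_mult_vec)
  show ?thesis
    unfolding orb
  proof
    assume "diag_point t' \<in> G_orbit (diag_point t)"
    then obtain a b c d where K: "a \<in> K" "b \<in> K" "c \<in> K" "d \<in> K" and det: "a * d - b * c \<noteq> 0"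
      and eq: "diag_point t' = vec.span {G_matrix a b c d *v ?x}"
      unfolding diag_point_def[of t] G_orbit_span[OF vector_1_0_neq_0] by blast
    have "G_matrix a b c d *v ?x \<in> diag_point t'"
      unfolding eq by (rule vec.span_base) simp
    then obtain m where m: "G_matrix a b c d *v ?x = m *s vector [1, 0, t']"
      unfolding diag_point_def vec.span_singleton by blast
    have "a\<^sup>2 + c\<^sup>2 * t = m" "a * b + c * d * t = 0" "b\<^sup>2 + d\<^sup>2 * t = m * t'"
      using gx[of a b c d] unfolding m by (simp_all add: algebra_simps)
    have "c * d = 0"
    proof (rule ccontr)
      assume "c * d \<noteq> 0"
      then have "t = - (a * b) / (c * d)"
        using \<open>a * b + c * d * t = 0\<close> by (simp add: field_simps eq_neg_iff_add_eq_0)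
      then show False
        using nonsquares_not_in_subfield[OF t] K K_closed(3,6,8) by simp
    qed
    then have "a * b = 0" using \<open>a * b + c * d * t = 0\<close> by (metis add.right_neutral mult_zero_left)
    show "\<exists>k\<in>K - {0}. t' = k\<^sup>2 * t \<or> t' = k\<^sup>2 / t"
    proof (cases "a = 0")
      case True
      then have "b \<noteq> 0" "c \<noteq> 0" using det by auto
      then have "d = 0" using \<open>c * d = 0\<close> by simp
      have "t' = (b / c)\<^sup>2 / t"
        using True \<open>d = 0\<close> \<open>c \<noteq> 0\<close> t0 \<open>b\<^sup>2 + d\<^sup>2 * t = m * t'\<close> \<open>a\<^sup>2 + c\<^sup>2 * t = m\<close>
        by (auto simp: power_divide field_simps)
      then show ?thesis
        using K K_closed(8) \<open>b \<noteq> 0\<close> \<open>c \<noteq> 0\<close> by (intro bexI[of _ "b / c"]) auto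
    next
      case False
      then have "b = 0" using \<open>a * b = 0\<close> by simp
      then have "d \<noteq> 0" using det by auto
      then have "c = 0" using \<open>c * d = 0\<close> by simp
      have "t' = (d / a)\<^sup>2 * t"
        using False \<open>b = 0\<close> \<open>c = 0\<close> \<open>b\<^sup>2 + d\<^sup>2 * t = m * t'\<close> \<open>a\<^sup>2 + c\<^sup>2 * t = m\<close>
        by (auto simp: power_divide field_simps)
      then show ?thesis
        using K K_closed(8) \<open>d \<noteq> 0\<close> False by (intro bexI[of _ "d / a"]) auto
    qed
  next
    have diag: "diag_point t' = vec.span {v}" if "v = m *s vector [1, 0, t']" "m \<noteq> 0" for v m
    proof (rule pg_points_eq_span[OF diag_point_in_pg_points])
      show "v \<in> diag_point t'"
        unfolding diag_point_def vec.span_singleton using that by blast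
      show "v \<noteq> 0" using that by (simp add: vec_eq_iff forall_3)
    qed
    have memI: "diag_point t' \<in> G_orbit (diag_point t)"
      if "a \<in> K" "b \<in> K" "c \<in> K" "d \<in> K" "a * d - b * c \<noteq> 0"
        "G_matrix a b c d *v ?x = m *s vector [1, 0, t']" "m \<noteq> 0" for a b c d m
      unfolding diag_point_def[of t] G_orbit_span[OF vector_1_0_neq_0]
      using diag[OF that(6,7)] that by blast
    assume "\<exists>k\<in>K - {0}. t' = k\<^sup>2 * t \<or> t' = k\<^sup>2 / t"
    then obtain k where k: "k \<in> K" "k \<noteq> 0" "t' = k\<^sup>2 * t \<or> t' = k\<^sup>2 / t" by blast
    from k(3) show "diag_point t' \<in> G_orbit (diag_point t)"
    proof
      assume "t' = k\<^sup>2 * t"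
      then show ?thesis
        using k K_closed(1,2) by (intro memI[of 1 0 0 k 1]) (auto simp: vec_eq_iff forall_3 gx)
    next
      assume "t' = k\<^sup>2 / t"
      then show ?thesis
        using k K_closed(1,2) t0 by (intro memI[of 0 k 1 0 t]) (auto simp: vec_eq_iff forall_3 gx)
    qed
  qed
qed

text \<open>Each of the families \<open>k^2 * t\<close> and \<open>k^2 / t\<close> has
  \<open>(s - 1) / 2\<close> members. They are disjoint, since \<open>k^2 * t = l^2 / t\<close>
  would put \<open>t\<close> in \<open>K\<close>.\<close>

lemma card_diag_orbit_fibre:
  assumes t: "t \<in> nonsquares"
  shows "card {t' \<in> nonsquares. G_orbit (diag_point t') = G_orbit (diag_point t)} = s - 1"
proof -
  let ?S = "(\<lambda>x. x\<^sup>2) ` (K - {0})"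
  have t0: "t \<noteq> 0" using t by (auto simp: nonsquares_def)
  have sub: "k\<^sup>2 * t \<in> nonsquares" "k\<^sup>2 / t \<in> nonsquares" if "k \<noteq> 0" for k
  proof -
    show "k\<^sup>2 * t \<in> nonsquares"
      using t is_square_smult_iff[OF that, of t] by (simp add: nonsquares_def)
    have "k\<^sup>2 / t = (k / t)\<^sup>2 * t" "k / t \<noteq> 0"
      using t0 that by (simp_all add: power2_eq_square)
    then show "k\<^sup>2 / t \<in> nonsquares"
      using t is_square_smult_iff[of "k / t" t] by (simp add: nonsquares_def)
  qed
  have "{t' \<in> nonsquares. G_orbit (diag_point t') = G_orbit (diag_point t)}
      = (\<lambda>z. z * t) ` ?S \<union> (\<lambda>z. z / t) ` ?S"
    unfolding diag_points_same_orbit_iff[OF t] using sub by auto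
  also have "card \<dots> = card ((\<lambda>z. z * t) ` ?S) + card ((\<lambda>z. z / t) ` ?S)"
  proof (rule card_Un_disjoint)
    have False if "k \<in> K" "l \<in> K" "k \<noteq> 0" "l \<noteq> 0" "k\<^sup>2 * t = l\<^sup>2 / t" for k l
    proof -
      have "t\<^sup>2 = (l / k)\<^sup>2"
        using that t0 by (simp add: power_divide power2_eq_square field_simps)
      then have "t = l / k \<or> t = - (l / k)" by (simp only: power2_eq_iff)
      then show False
        using nonsquares_not_in_subfield[OF t] that K_closed(3,8) by blast
    qed
    then show "(\<lambda>z. z * t) ` ?S \<inter> (\<lambda>z. z / t) ` ?S = {}" by blast
  qed auto
  also have "card ((\<lambda>z. z * t) ` ?S) = card ?S"
    using t0 by (intro card_image) (auto simp: inj_on_def)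
  also have "card ((\<lambda>z. z / t) ` ?S) = card ?S"
    using t0 by (intro card_image) (auto simp: inj_on_def)
  finally show ?thesis
    using card_subfield_squares[OF subfield two_neq_0] by (simp add: card_K)
qed

lemma card_diag_orbits: "card ((\<lambda>t. G_orbit (diag_point t)) ` nonsquares) = (s + 1) div 2"
proof -
  let ?n = "card ((\<lambda>t. G_orbit (diag_point t)) ` nonsquares)"
  \<comment> \<open>This form of \<open>s\<close> shows that \<open>s - 1\<close> is nonzero and can
    be cancelled below.\<close>
  obtain m where m: "s = 4 * m + 3" by (rule s_eq)
  have "card nonsquares = ?n * (s - 1)"
    by (rule card_eq_card_image_times) (auto simp: card_diag_orbit_fibre)
  then have "2 * (?n * (s - 1)) = s\<^sup>2 - 1"
    using card_nonsquares by simp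
  also have "s\<^sup>2 - 1 = (s + 1) * (s - 1)"
    by (simp add: m power2_eq_square algebra_simps)
  finally have "(2 * ?n) * (s - 1) = (s + 1) * (s - 1)" by simp
  then have "2 * ?n = s + 1"
    using m by (simp only: mult_cancel2) simp
  then show ?thesis by simp
qed

lemma polar_avoiding_internal_orbits:
  "{Orb \<in> orbits (G_group K) pg_points (\<lambda>g. g).
      (\<forall>P\<in>Orb. internal P) \<and> (\<forall>P\<in>Orb. \<forall>R\<in>G_orbit P. \<not> R \<subseteq> polar P)}
    = (\<lambda>t. G_orbit (diag_point t)) ` nonsquares" (is "?L = ?R")
proof
  show "?L \<subseteq> ?R"
  proof
    fix Orb assume "Orb \<in> ?L"
    then obtain P where P: "P \<in> pg_points" "Orb = G_orbit P"
      and int: "\<forall>P\<in>Orb. internal P" and avoid: "\<forall>P\<in>Orb. \<forall>R\<in>G_orbit P. \<not> R \<subseteq> polar P"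
      by (auto simp: orbits_def)
    have "P \<in> Orb" using P action.orbit_refl by blast
    then obtain t where "t \<in> nonsquares" "P \<in> G_orbit (diag_point t)"
      using internal_avoiding_in_diag_orbit int avoid by blast
    then show "Orb \<in> ?R"
      using P(2) G_orbit_eq[OF diag_point_in_pg_points] by blast
  qed
  show "?R \<subseteq> ?L"
  proof clarify
    fix t assume t: "t \<in> nonsquares"
    have "G_orbit (diag_point t) \<in> orbits (G_group K) pg_points (\<lambda>g. g)"
      using diag_point_in_pg_points by (auto simp: orbits_def)
    moreover have "\<not> R \<subseteq> polar P" if "P \<in> G_orbit (diag_point t)" "R \<in> G_orbit P" for P R
      using polar_avoids_orbit_invariant[OF diag_point_in_pg_points] t that
        diag_point_orbit_not_subset_polar by metis
    ultimately show "G_orbit (diag_point t) \<in> orbits (G_group K) pg_points (\<lambda>g. g) \<and>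
        (\<forall>P\<in>G_orbit (diag_point t). internal P) \<and>
        (\<forall>P\<in>G_orbit (diag_point t). \<forall>R\<in>G_orbit P. \<not> R \<subseteq> polar P)"
      using internal_G_orbit_diag_point[OF t] by blast
  qed
qed

end

theorem theorem2p7:
  fixes K :: "'a::{field,finite} set" and p h q s :: nat
  assumes "prime p" and "odd p" and "h > 0" and "q = p ^ (2 * h)"
    and "s\<^sup>2 = q" and "[int s = -1] (mod 4)"
    and "CARD('a) = q"
    and "is_subfield K" and "card K = s"
  shows "card {Orb \<in> orbits (G_group K) pg_points (\<lambda>g. g).
           (\<forall>P\<in>Orb. internal P) \<and>
           (\<forall>P\<in>Orb. \<forall>R\<in>orbit (G_group K) (\<lambda>g. g) P. \<not> R \<subseteq> polar P)} = (s + 1) div 2"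
proof -
  have "int s mod 4 = 3"
    using assms(6) by (simp add: cong_def)
  then have "s mod 4 = 3"
    by presburger
  then interpret quadratic_subfield K s
    by unfold_locales (use assms in auto)
  show ?thesis
    unfolding polar_avoiding_internal_orbits by (rule card_diag_orbits)
qed

end
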